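(* Let $(M,\circ,e,\mathcal{E},\tilde{\mathcal{S}})$ be an $F$-manifold with an eventual identity $\mathcal{E}$ and a special family of connections $\tilde{\mathcal{S}}$. Assume that there is $\tilde{\nabla}\in\tilde{\mathcal{S}}$ which is flat. Then the dual family $\mathcal{S}=\mathcal{D}_{\mathcal{E}}(\tilde{\mathcal{S}})$ on the dual $F$-manifold $(M,*,\mathcal{E})$ contains a flat connection if and only if there is a vector field $\tilde{W}$ such that, for any $X,Y,Z\in\mathcal{X}(M)$, $$\left(\tilde{\nabla}^{2}_{X,Y}(\mathcal{E})-\tilde{\nabla}_{X}(\tilde{\mathcal{C}}_{\tilde{W}})(Y)\right)\circ Z=\left(\tilde{\nabla}^{2}_{Z,Y}(\mathcal{E})-\tilde{\nabla}_{Z}(\tilde{\mathcal{C}}_{\tilde{W}})(Y)\right)\circ X.$$ If this relation holds, then the connection $$\nabla^{W}_{X}(Y):=\mathcal{E}\circ\tilde{\nabla}_{X}(\mathcal{E}^{-1}\circ Y)-\tilde{\nabla}_{\mathcal{E}^{-1}\circ Y}(\mathcal{E})\circ X+W*X*Y,$$ with $W:=\tilde{W}\circ\mathcal{E}$, is flat (and belongs to $\mathcal{D}_{\mathcal{E}}(\tilde{\mathcal{S}})$).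
   Context: Everything is in the smooth category; $\mathcal{X}(M)$ denotes the vector fields on the manifold $M$. A connection is flat if its curvature vanishes. $F$-manifold: a triple $(M,\circ,e)$ where $M$ is a manifold and $\circ$ is a fiber-preserving commutative, associative, bilinear multiplication on $TM$ with unit field $e$, such that $L_{X\circ Y}(\circ)=X\circ L_{Y}(\circ)+Y\circ L_{X}(\circ)$ for all $X,Y\in\mathcal{X}(M)$, where $L_{Z}(\circ)(X,Y)=[Z,X\circ Y]-[Z,X]\circ Y-X\circ[Z,Y]$. Invertible vector field: $\mathcal{E}$ is invertible if there is a vector field $\mathcal{E}^{-1}$ with $\mathcal{E}\circ\mathcal{E}^{-1}=e$. Eventual identity on an $F$-manifold $(M,\circ,e)$: an invertible vector field $\mathcal{E}$ such that the multiplication $X*Y:=X\circ Y\circ\mathcal{E}^{-1}$ (whose unit field is $\mathcal{E}$) defines an $F$-manifold $(M,*,\mathcal{E})$, called the dual $F$-manifold. Compatible connection: a connection $\nabla$ on $TM$ is compatible with a commutative, associative multiplication $\circ$ on $TM$ if $\nabla_{X}(\circ)(Y,Z):=\nabla_{X}(Y\circ Z)-\nabla_{X}(Y)\circ Z-Y\circ\nabla_{X}(Z)$ is totally symmetric in $X,Y,Z$. Special family: a family of connections $\tilde{\mathcal{S}}$ on an $F$-manifold $(M,\circ,e)$ is special if $\tilde{\mathcal{S}}=\{\tilde{\nabla}^{V},\ V\in\mathcal{X}(M)\}$ where $\tilde{\nabla}^{V}_{X}(Y):=\tilde{\nabla}_{X}(Y)+V\circ X\circ Y$ and $\tilde{\nabla}$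 is torsion-free and compatible with $\circ$ (all members of the family are then torsion-free and compatible with $\circ$). Dual family: $\mathcal{D}_{\mathcal{E}}(\tilde{\mathcal{S}})=\{\nabla^{W},\ W\in\mathcal{X}(M)\}$ where $\nabla^{W}_{X}(Y)=\mathcal{E}\circ\tilde{\nabla}_{X}(\mathcal{E}^{-1}\circ Y)-\tilde{\nabla}_{\mathcal{E}^{-1}\circ Y}(\mathcal{E})\circ X+W*X*Y$ and $\tilde{\nabla}\in\tilde{\mathcal{S}}$ is any connection of the family (the result does not depend on this choice); it is a special family on $(M,*,\mathcal{E})$. Notation: $\tilde{\nabla}^{2}_{X,Y}(\mathcal{E}):=\tilde{\nabla}_{X}\tilde{\nabla}_{Y}\mathcal{E}-\tilde{\nabla}_{\tilde{\nabla}_{X}Y}\mathcal{E}$. For a vector field $V$, $\tilde{\mathcal{C}}_{V}$ is the section of $\mathrm{End}(TM)$ given by $\tilde{\mathcal{C}}_{V}(X)=X\circ V$, and $\tilde{\nabla}_{X}(\tilde{\mathcal{C}}_{V})(Y)=\tilde{\nabla}_{X}(V\circ Y)-V\circ\tilde{\nabla}_{X}(Y)$. *)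

theory Defs
  imports "HOL-Analysis.Analysis" "HOL-Library.Function_Algebras" "HOL-Library.FuncSet"
begin

section \<open>Smooth manifolds\<close>

text \<open>In finite dimension, and on an open set \<open>S\<close>, this is the usual notion of a map of
  class \<open>C\<^sup>k\<close>: all iterated directional derivatives up to order \<open>k\<close> exist and are continuous.\<close>

primrec Ck_on :: "nat \<Rightarrow> 'b::euclidean_space set \<Rightarrow> ('b \<Rightarrow> 'c::real_normed_vector) \<Rightarrow> bool" where
  "Ck_on 0 S f \<longleftrightarrow> continuous_on S f"
| "Ck_on (Suc k) S f \<longleftrightarrow>
     (\<forall>x\<in>S. f differentiable (at x)) \<and> (\<forall>v. Ck_on k S (\<lambda>x. frechet_derivative f (at x) v))"

definition smooth_on :: "'b::euclidean_space set \<Rightarrow> ('b \<Rightarrow> 'c::real_normed_vector) \<Rightarrow> bool" where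
  "smooth_on S f \<longleftrightarrow> (\<forall>k. Ck_on k S f)"

text \<open>The underlying set of the manifold is the whole type \<open>'a\<close>. A chart is a pair \<open>(U, \<phi>)\<close>;
  only the values of \<open>\<phi>\<close> on \<open>U\<close> matter. The atlas need not be maximal.\<close>

type_synonym ('a, 'b) atlas = "('a set \<times> ('a \<Rightarrow> 'b)) set"

definition chart :: "'a::topological_space set \<Rightarrow> ('a \<Rightarrow> 'b::euclidean_space) \<Rightarrow> bool" where
  "chart U \<phi> \<longleftrightarrow> open U \<and> open (\<phi> ` U) \<and> homeomorphism U (\<phi> ` U) \<phi> (inv_into U \<phi>)"

definition smooth_atlas ::
    "('a::{t2_space, second_countable_topology}, 'b::euclidean_space) atlas \<Rightarrow> bool" where
  "smooth_atlas A \<longleftrightarrow>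
     (\<forall>(U, \<phi>)\<in>A. chart U \<phi>) \<and>
     (\<Union>(U, \<phi>)\<in>A. U) = UNIV \<and>
     (\<forall>(U, \<phi>)\<in>A. \<forall>(V, \<psi>)\<in>A. smooth_on (\<phi> ` (U \<inter> V)) (\<psi> \<circ> inv_into U \<phi>))"

definition smooth_fun :: "('a, 'b::euclidean_space) atlas \<Rightarrow> ('a \<Rightarrow> real) set" where
  "smooth_fun A = {f. \<forall>(U, \<phi>)\<in>A. smooth_on (\<phi> ` U) (f \<circ> inv_into U \<phi>)}"


section \<open>Tangent vectors and vector fields\<close>

text \<open>A tangent vector at \<open>p\<close> is a derivation at \<open>p\<close> of the algebra of smooth functions. It is
  required to vanish on functions that are not smooth, so that two tangent vectors
  are equal in HOL iff they agree as derivations.\<close>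

type_synonym 'a tvec = "('a \<Rightarrow> real) \<Rightarrow> real"
type_synonym 'a vfield = "'a \<Rightarrow> 'a tvec"

definition tangent_space :: "('a, 'b::euclidean_space) atlas \<Rightarrow> 'a \<Rightarrow> 'a tvec set" where
  "tangent_space A p = {v.
     (\<forall>f\<in>smooth_fun A. \<forall>g\<in>smooth_fun A. v (\<lambda>x. f x + g x) = v f + v g) \<and>
     (\<forall>c. \<forall>f\<in>smooth_fun A. v (\<lambda>x. c * f x) = c * v f) \<and>
     (\<forall>f\<in>smooth_fun A. \<forall>g\<in>smooth_fun A. v (\<lambda>x. f x * g x) = f p * v g + g p * v f) \<and>
     (\<forall>f. f \<notin> smooth_fun A \<longrightarrow> v f = 0)}"

definition vfields :: "('a, 'b::euclidean_space) atlas \<Rightarrow> 'a vfield set" where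
  "vfields A = {X. (\<forall>p. X p \<in> tangent_space A p) \<and>
                   (\<forall>f\<in>smooth_fun A. (\<lambda>p. X p f) \<in> smooth_fun A)}"

definition fscale :: "('a \<Rightarrow> real) \<Rightarrow> 'a vfield \<Rightarrow> 'a vfield" where
  "fscale g X = (\<lambda>p f. g p * X p f)"

definition lie_bracket :: "'a vfield \<Rightarrow> 'a vfield \<Rightarrow> 'a vfield" where
  "lie_bracket X Y = (\<lambda>p f. X p (\<lambda>q. Y q f) - Y p (\<lambda>q. X q f))"


section \<open>Multiplications on the tangent bundle and F-manifolds\<close>

type_synonym 'a tmult = "'a \<Rightarrow> 'a tvec \<Rightarrow> 'a tvec \<Rightarrow> 'a tvec"

definition vmult :: "'a vfield \<Rightarrow> 'a tmult \<Rightarrow> 'a vfield \<Rightarrow> 'a vfield"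
    ("(_ \<odot>\<^bsub>_\<^esub> _)" [70, 0, 71] 70) where
  "X \<odot>\<^bsub>m\<^esub> Y = (\<lambda>p. m p (X p) (Y p))"

text \<open>Linearity in the first argument suffices, by commutativity. The last clause
  is the smoothness of the multiplication.\<close>

definition comm_assoc_mult :: "('a, 'b::euclidean_space) atlas \<Rightarrow> 'a tmult \<Rightarrow> bool" where
  "comm_assoc_mult A m \<longleftrightarrow>
     (\<forall>p. \<forall>u\<in>tangent_space A p. \<forall>v\<in>tangent_space A p.
        m p u v \<in> tangent_space A p \<and> m p u v = m p v u \<and>
        (\<forall>c. m p (\<lambda>f. c * u f) v = (\<lambda>f. c * m p u v f)) \<and>
        (\<forall>w\<in>tangent_space A p.
           m p (u + v) w = m p u w + m p v w \<and>
           m p (m p u v) w = m p u (m p v w))) \<and>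
     (\<forall>X\<in>vfields A. \<forall>Y\<in>vfields A. X \<odot>\<^bsub>m\<^esub> Y \<in> vfields A)"

definition unit_field :: "('a, 'b::euclidean_space) atlas \<Rightarrow> 'a tmult \<Rightarrow> 'a vfield \<Rightarrow> bool" where
  "unit_field A m e \<longleftrightarrow> e \<in> vfields A \<and> (\<forall>p. \<forall>v\<in>tangent_space A p. m p (e p) v = v)"

definition lie_mult :: "'a tmult \<Rightarrow> 'a vfield \<Rightarrow> 'a vfield \<Rightarrow> 'a vfield \<Rightarrow> 'a vfield" where
  "lie_mult m Z X Y =
     lie_bracket Z (X \<odot>\<^bsub>m\<^esub> Y) - lie_bracket Z X \<odot>\<^bsub>m\<^esub> Y - X \<odot>\<^bsub>m\<^esub> lie_bracket Z Y"

definition F_manifold ::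
    "('a::{t2_space, second_countable_topology}, 'b::euclidean_space) atlas \<Rightarrow>
     'a tmult \<Rightarrow> 'a vfield \<Rightarrow> bool" where
  "F_manifold A m e \<longleftrightarrow>
     smooth_atlas A \<and> comm_assoc_mult A m \<and> unit_field A m e \<and>
     (\<forall>X\<in>vfields A. \<forall>Y\<in>vfields A. \<forall>Z\<in>vfields A. \<forall>V\<in>vfields A.
        lie_mult m (X \<odot>\<^bsub>m\<^esub> Y) Z V = X \<odot>\<^bsub>m\<^esub> lie_mult m Y Z V + Y \<odot>\<^bsub>m\<^esub> lie_mult m X Z V)"


section \<open>Eventual identities\<close>

definition invertible_field ::
    "('a, 'b::euclidean_space) atlas \<Rightarrow> 'a tmult \<Rightarrow> 'a vfield \<Rightarrow> 'a vfield \<Rightarrow> bool" where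
  "invertible_field A m e E \<longleftrightarrow> E \<in> vfields A \<and> (\<exists>F\<in>vfields A. E \<odot>\<^bsub>m\<^esub> F = e)"

definition inverse_field ::
    "('a, 'b::euclidean_space) atlas \<Rightarrow> 'a tmult \<Rightarrow> 'a vfield \<Rightarrow> 'a vfield \<Rightarrow> 'a vfield" where
  "inverse_field A m e E = (THE F. F \<in> vfields A \<and> E \<odot>\<^bsub>m\<^esub> F = e)"

definition dual_mult ::
    "('a, 'b::euclidean_space) atlas \<Rightarrow> 'a tmult \<Rightarrow> 'a vfield \<Rightarrow> 'a vfield \<Rightarrow> 'a tmult" where
  "dual_mult A m e E = (\<lambda>p u v. m p (m p u v) (inverse_field A m e E p))"

definition eventual_identity ::
    "('a::{t2_space, second_countable_topology}, 'b::euclidean_space) atlas \<Rightarrow>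
     'a tmult \<Rightarrow> 'a vfield \<Rightarrow> 'a vfield \<Rightarrow> bool" where
  "eventual_identity A m e E \<longleftrightarrow>
     invertible_field A m e E \<and> F_manifold A (dual_mult A m e E) E"


section \<open>Connections\<close>

text \<open>Connections are extensional in both arguments, so that two connections are equal in HOL
  iff they agree on vector fields; families of connections are then ordinary sets.\<close>

type_synonym 'a conn = "'a vfield \<Rightarrow> 'a vfield \<Rightarrow> 'a vfield"

definition connection :: "('a, 'b::euclidean_space) atlas \<Rightarrow> 'a conn \<Rightarrow> bool" where
  "connection A D \<longleftrightarrow>
     D \<in> vfields A \<rightarrow>\<^sub>E vfields A \<rightarrow>\<^sub>E vfields A \<and>
     (\<forall>X\<in>vfields A. \<forall>Y\<in>vfields A. \<forall>Z\<in>vfields A.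
        D (X + Y) Z = D X Z + D Y Z \<and> D X (Y + Z) = D X Y + D X Z) \<and>
     (\<forall>f\<in>smooth_fun A. \<forall>X\<in>vfields A. \<forall>Y\<in>vfields A.
        D (fscale f X) Y = fscale f (D X Y) \<and>
        D X (fscale f Y) = fscale (\<lambda>p. X p f) Y + fscale f (D X Y))"

definition torsion_free :: "('a, 'b::euclidean_space) atlas \<Rightarrow> 'a conn \<Rightarrow> bool" where
  "torsion_free A D \<longleftrightarrow>
     (\<forall>X\<in>vfields A. \<forall>Y\<in>vfields A. D X Y - D Y X = lie_bracket X Y)"

definition curvature :: "'a conn \<Rightarrow> 'a vfield \<Rightarrow> 'a vfield \<Rightarrow> 'a vfield \<Rightarrow> 'a vfield" where
  "curvature D X Y Z = D X (D Y Z) - D Y (D X Z) - D (lie_bracket X Y) Z"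

definition flat_connection :: "('a, 'b::euclidean_space) atlas \<Rightarrow> 'a conn \<Rightarrow> bool" where
  "flat_connection A D \<longleftrightarrow> connection A D \<and>
     (\<forall>X\<in>vfields A. \<forall>Y\<in>vfields A. \<forall>Z\<in>vfields A. curvature D X Y Z = 0)"

definition deriv_mult ::
    "'a conn \<Rightarrow> 'a tmult \<Rightarrow> 'a vfield \<Rightarrow> 'a vfield \<Rightarrow> 'a vfield \<Rightarrow> 'a vfield" where
  "deriv_mult D m X Y Z = D X (Y \<odot>\<^bsub>m\<^esub> Z) - D X Y \<odot>\<^bsub>m\<^esub> Z - Y \<odot>\<^bsub>m\<^esub> D X Z"

text \<open>Total symmetry is expressed through two transpositions, which generate all
  permutations of the three arguments.\<close>

definition compatible :: "('a, 'b::euclidean_space) atlas \<Rightarrow> 'a tmult \<Rightarrow> 'a conn \<Rightarrow> bool" where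
  "compatible A m D \<longleftrightarrow>
     (\<forall>X\<in>vfields A. \<forall>Y\<in>vfields A. \<forall>Z\<in>vfields A.
        deriv_mult D m X Y Z = deriv_mult D m Y X Z \<and>
        deriv_mult D m X Y Z = deriv_mult D m X Z Y)"

definition shifted_connection ::
    "('a, 'b::euclidean_space) atlas \<Rightarrow> 'a tmult \<Rightarrow> 'a conn \<Rightarrow> 'a vfield \<Rightarrow> 'a conn" where
  "shifted_connection A m D V =
     (\<lambda>X\<in>vfields A. \<lambda>Y\<in>vfields A. D X Y + V \<odot>\<^bsub>m\<^esub> X \<odot>\<^bsub>m\<^esub> Y)"

definition special_family ::
    "('a, 'b::euclidean_space) atlas \<Rightarrow> 'a tmult \<Rightarrow> 'a conn set \<Rightarrow> bool" where
  "special_family A m S \<longleftrightarrow>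
     (\<exists>D. connection A D \<and> torsion_free A D \<and> compatible A m D \<and>
          S = {shifted_connection A m D V | V. V \<in> vfields A})"

definition dual_connection ::
    "('a, 'b::euclidean_space) atlas \<Rightarrow> 'a tmult \<Rightarrow> 'a vfield \<Rightarrow> 'a vfield \<Rightarrow>
     'a conn \<Rightarrow> 'a vfield \<Rightarrow> 'a conn" where
  "dual_connection A m e E D W =
     (let E' = inverse_field A m e E; m' = dual_mult A m e E in
      (\<lambda>X\<in>vfields A. \<lambda>Y\<in>vfields A.
        E \<odot>\<^bsub>m\<^esub> D X (E' \<odot>\<^bsub>m\<^esub> Y) - D (E' \<odot>\<^bsub>m\<^esub> Y) E \<odot>\<^bsub>m\<^esub> X + W \<odot>\<^bsub>m'\<^esub> X \<odot>\<^bsub>m'\<^esub> Y))"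

text \<open>On a special family every base connection \<open>D \<in> S\<close> yields the same set of dual connections,
  so the union over all of them is the family obtained from any single one.\<close>

definition dual_family ::
    "('a, 'b::euclidean_space) atlas \<Rightarrow> 'a tmult \<Rightarrow> 'a vfield \<Rightarrow> 'a vfield \<Rightarrow>
     'a conn set \<Rightarrow> 'a conn set" where
  "dual_family A m e E S = {dual_connection A m e E D W | D W. D \<in> S \<and> W \<in> vfields A}"

definition second_deriv :: "'a conn \<Rightarrow> 'a vfield \<Rightarrow> 'a vfield \<Rightarrow> 'a vfield \<Rightarrow> 'a vfield" where
  "second_deriv D X Y E = D X (D Y E) - D (D X Y) E"

text \<open>The covariant derivative of the endomorphism field \<open>Y \<mapsto> Y \<odot> V\<close>.\<close>

definition deriv_mult_endo ::
    "'a conn \<Rightarrow> 'a tmult \<Rightarrow> 'a vfield \<Rightarrow> 'a vfield \<Rightarrow> 'a vfield \<Rightarrow> 'a vfield" where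
  "deriv_mult_endo D m X V Y = D X (V \<odot>\<^bsub>m\<^esub> Y) - V \<odot>\<^bsub>m\<^esub> D X Y"

definition flatness_relation ::
    "('a, 'b::euclidean_space) atlas \<Rightarrow> 'a tmult \<Rightarrow> 'a conn \<Rightarrow> 'a vfield \<Rightarrow> 'a vfield \<Rightarrow> bool" where
  "flatness_relation A m D E W \<longleftrightarrow>
     (\<forall>X\<in>vfields A. \<forall>Y\<in>vfields A. \<forall>Z\<in>vfields A.
        (second_deriv D X Y E - deriv_mult_endo D m X W Y) \<odot>\<^bsub>m\<^esub> Z =
        (second_deriv D Z Y E - deriv_mult_endo D m Z W Y) \<odot>\<^bsub>m\<^esub> X)"

end

(*
  Since the dual F-manifold has unit E, its defining identity gives L_E( * ) = 0, which
  unwinds to L_E(o)(X, Y) = [e, E] o X o Y.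

  Put W~ = W o E^{-1} and T(Y) = D_Y E - W~ o Y. Conjugating the dual connection by Y |-> E^{-1} o Y
  gives B_X Y = D_X Y - E^{-1} o X o T(Y). If D is flat, its torsion-freeness and compatibility and the
  identity for L_E(o) make every term of the curvature of B cancel except
  E^{-1} o ((D_Z T)(Y) o X - (D_X T)(Y) o Z), where (D_X T)(Y) = D^2_{X,Y} E - (D_X C_{W~})(Y).
*)

theory Submission
  imports Defs
begin

section \<open>Calculus of functions of finite order and of smooth functions\<close>

text \<open>The derivative at a point of an open set depends only on the values there. This allows
  \<open>frechet_derivative\<close>, which is a choice operator, to be replaced on \<open>S\<close>
  by an explicit formula in the sum and product rules.\<close>

lemma Ck_on_cong:
  assumes "open S" and "\<And>x. x \<in> S \<Longrightarrow> f x = g x" and "Ck_on k S f"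
  shows "Ck_on k S g"
  using assms(2,3)
proof (induction k arbitrary: f g)
  case 0
  then show ?case by (simp cong: continuous_on_cong)
next
  case (Suc k)
  have d: "(g has_derivative frechet_derivative f (at x)) (at x)" if "x \<in> S" for x
  proof (rule has_derivative_transform_within_open[OF _ assms(1) that])
    show "(f has_derivative frechet_derivative f (at x)) (at x)"
      using Suc.prems that by (simp add: frechet_derivative_works[symmetric])
  qed (rule Suc.prems(1))
  have e: "frechet_derivative f (at x) = frechet_derivative g (at x)" if "x \<in> S" for x
    using frechet_derivative_at[OF d[OF that]] .
  have "Ck_on k S (\<lambda>x. frechet_derivative g (at x) v)" for v
    by (rule Suc.IH[of "\<lambda>x. frechet_derivative f (at x) v"]) (use e Suc.prems(2) in simp_all)
  moreover have "g differentiable (at x)" if "x \<in> S" for x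
    using d[OF that] by (rule differentiableI)
  ultimately show ?case by simp
qed

lemma Ck_on_SucD: "Ck_on (Suc k) S f \<Longrightarrow> Ck_on k S f"
proof (induction k arbitrary: f)
  case 0
  then show ?case
    by (auto intro!: differentiable_imp_continuous_on simp: differentiable_on_def differentiable_at_withinI)
next
  case (Suc k)
  then show ?case by (metis Ck_on.simps(2))
qed

lemma Ck_on_const: "Ck_on k S (\<lambda>x. c)"
  by (induction k arbitrary: c) (simp_all add: frechet_derivative_const)

lemma Ck_on_add:
  assumes "open S" and "Ck_on k S f" and "Ck_on k S g"
  shows "Ck_on k S (\<lambda>x. f x + g x)"
  using assms(2,3)
proof (induction k arbitrary: f g)
  case 0
  then show ?case by (simp add: continuous_on_add)
next
  case (Suc k)
  have d: "((\<lambda>x. f x + g x) has_derivative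
      (\<lambda>v. frechet_derivative f (at x) v + frechet_derivative g (at x) v)) (at x)" if "x \<in> S" for x
    using Suc.prems that by (auto intro!: has_derivative_add simp: frechet_derivative_works[symmetric])
  have "Ck_on k S (\<lambda>x. frechet_derivative (\<lambda>x. f x + g x) (at x) v)" for v
  proof (rule Ck_on_cong[OF assms(1)])
    show "Ck_on k S (\<lambda>x. frechet_derivative f (at x) v + frechet_derivative g (at x) v)"
      using Suc by auto
  qed (simp add: frechet_derivative_at[OF d, symmetric])
  with d show ?case by (auto simp: differentiable_def)
qed

lemma Ck_on_mult:
  fixes f g :: "'b::euclidean_space \<Rightarrow> 'c::real_normed_algebra"
  assumes "open S" and "Ck_on k S f" and "Ck_on k S g"
  shows "Ck_on k S (\<lambda>x. f x * g x)"
  using assms(2,3)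
proof (induction k arbitrary: f g)
  case 0
  then show ?case by (simp add: continuous_on_mult)
next
  case (Suc k)
  have d: "((\<lambda>x. f x * g x) has_derivative
      (\<lambda>v. f x * frechet_derivative g (at x) v + frechet_derivative f (at x) v * g x)) (at x)"
    if "x \<in> S" for x
    using Suc.prems that by (auto intro!: has_derivative_mult simp: frechet_derivative_works[symmetric])
  have "Ck_on k S (\<lambda>x. frechet_derivative (\<lambda>x. f x * g x) (at x) v)" for v
  proof (rule Ck_on_cong[OF assms(1)])
    show "Ck_on k S (\<lambda>x. f x * frechet_derivative g (at x) v + frechet_derivative f (at x) v * g x)"
      \<comment> \<open>The product rule keeps one factor undifferentiated; its order drops from
        \<open>Suc k\<close> to \<open>k\<close> to match the other factor.\<close>
      using Suc.prems Ck_on_SucD[OF Suc.prems(1)] Ck_on_SucD[OF Suc.prems(2)]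
      by (intro Ck_on_add[OF assms(1)] Suc.IH) auto
  qed (simp add: frechet_derivative_at[OF d, symmetric])
  with d show ?case by (auto simp: differentiable_def)
qed

lemma smooth_fun_const: "(\<lambda>x. c) \<in> smooth_fun A"
  by (auto simp: smooth_fun_def smooth_on_def comp_def Ck_on_const)

lemma smooth_fun_add:
  assumes "smooth_atlas A" and "f \<in> smooth_fun A" and "g \<in> smooth_fun A"
  shows "(\<lambda>x. f x + g x) \<in> smooth_fun A"
  using assms
  by (auto simp: smooth_fun_def smooth_on_def smooth_atlas_def chart_def comp_def
      intro!: Ck_on_add split: prod.splits)

lemma smooth_fun_mult:
  assumes "smooth_atlas A" and "f \<in> smooth_fun A" and "g \<in> smooth_fun A"
  shows "(\<lambda>x. f x * g x) \<in> smooth_fun A"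
  using assms
  by (auto simp: smooth_fun_def smooth_on_def smooth_atlas_def chart_def comp_def
      intro!: Ck_on_mult split: prod.splits)

section \<open>Vector fields as a module over the smooth functions\<close>

lemma tangent_space_add:
  "u \<in> tangent_space A p \<Longrightarrow> v \<in> tangent_space A p \<Longrightarrow> u + v \<in> tangent_space A p"
  by (auto simp: tangent_space_def algebra_simps)

lemma tangent_space_scale:
  "u \<in> tangent_space A p \<Longrightarrow> (\<lambda>f. c * u f) \<in> tangent_space A p"
  by (auto simp: tangent_space_def algebra_simps)

lemma vfields_add:
  assumes "smooth_atlas A" "X \<in> vfields A" "Y \<in> vfields A"
  shows "X + Y \<in> vfields A"
  using assms by (auto simp: vfields_def intro!: tangent_space_add smooth_fun_add)

lemma vfields_fscale:
  assumes "smooth_atlas A" "f \<in> smooth_fun A" "X \<in> vfields A"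
  shows "fscale f X \<in> vfields A"
  using assms by (auto simp: vfields_def fscale_def intro!: tangent_space_scale smooth_fun_mult)

lemma fscale_minus_one: "fscale (\<lambda>_. - 1) X = - X"
  by (simp add: fscale_def fun_eq_iff)

lemma vfields_uminus:
  assumes "smooth_atlas A" "X \<in> vfields A"
  shows "- X \<in> vfields A"
  using vfields_fscale[OF assms(1) smooth_fun_const assms(2), of "- 1"]
  by (simp add: fscale_minus_one)

section \<open>Commutative unital multiplications on an additive group\<close>

text \<open>The laws are relative to a carrier \<open>G\<close>, because the type of vector fields
  also contains functions that are not vector fields. The curvature identities are additive;
  multiplication by smooth functions is treated later, with the Leibniz rule.\<close>

locale unital_mult =
  fixes G :: "'v::ab_group_add set" and mul :: "'v \<Rightarrow> 'v \<Rightarrow> 'v" (infixl "\<diamond>" 70) and e :: 'v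
  assumes add_closed: "x \<in> G \<Longrightarrow> y \<in> G \<Longrightarrow> x + y \<in> G"
    and uminus_closed: "x \<in> G \<Longrightarrow> - x \<in> G"
    and mul_closed: "x \<in> G \<Longrightarrow> y \<in> G \<Longrightarrow> x \<diamond> y \<in> G"
    and mul_comm: "x \<in> G \<Longrightarrow> y \<in> G \<Longrightarrow> x \<diamond> y = y \<diamond> x"
    and mul_assoc: "x \<in> G \<Longrightarrow> y \<in> G \<Longrightarrow> z \<in> G \<Longrightarrow> x \<diamond> y \<diamond> z = x \<diamond> (y \<diamond> z)"
    and mul_add: "x \<in> G \<Longrightarrow> y \<in> G \<Longrightarrow> z \<in> G \<Longrightarrow> x \<diamond> (y + z) = x \<diamond> y + x \<diamond> z"
    and unit_closed: "e \<in> G"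
    and mul_unit: "x \<in> G \<Longrightarrow> e \<diamond> x = x"
begin

lemma diff_closed: "x \<in> G \<Longrightarrow> y \<in> G \<Longrightarrow> x - y \<in> G"
  using add_closed[of x "- y"] uminus_closed by simp

lemma zero_closed: "0 \<in> G"
  using diff_closed[OF unit_closed unit_closed] by simp

lemma mul_left_comm: "x \<in> G \<Longrightarrow> y \<in> G \<Longrightarrow> z \<in> G \<Longrightarrow> x \<diamond> (y \<diamond> z) = y \<diamond> (x \<diamond> z)"
  by (metis mul_assoc mul_comm)

lemma mul_zero: "x \<in> G \<Longrightarrow> x \<diamond> 0 = 0"
  using mul_add[of x 0 0] zero_closed by simp

lemma mul_uminus: "x \<in> G \<Longrightarrow> y \<in> G \<Longrightarrow> x \<diamond> (- y) = - (x \<diamond> y)"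
  using mul_add[of x y "- y"] uminus_closed by (simp add: mul_zero add_eq_0_iff)

lemma mul_diff: "x \<in> G \<Longrightarrow> y \<in> G \<Longrightarrow> z \<in> G \<Longrightarrow> x \<diamond> (y - z) = x \<diamond> y - x \<diamond> z"
  using mul_add[of x y "- z"] uminus_closed by (simp add: mul_uminus)

lemma add_mul: "x \<in> G \<Longrightarrow> y \<in> G \<Longrightarrow> z \<in> G \<Longrightarrow> (y + z) \<diamond> x = y \<diamond> x + z \<diamond> x"
  by (metis add_closed mul_add mul_comm)

lemma diff_mul: "x \<in> G \<Longrightarrow> y \<in> G \<Longrightarrow> z \<in> G \<Longrightarrow> (y - z) \<diamond> x = y \<diamond> x - z \<diamond> x"
  by (metis diff_closed mul_diff mul_comm)

lemma uminus_mul: "x \<in> G \<Longrightarrow> y \<in> G \<Longrightarrow> (- y) \<diamond> x = - (y \<diamond> x)"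
  by (metis uminus_closed mul_uminus mul_comm)

lemma mul_unit_right: "x \<in> G \<Longrightarrow> x \<diamond> e = x"
  by (metis mul_comm mul_unit unit_closed)

lemmas closed = add_closed uminus_closed diff_closed zero_closed mul_closed unit_closed

lemmas mul_simps = closed mul_assoc mul_comm mul_left_comm mul_add mul_diff mul_uminus
  add_mul diff_mul uminus_mul mul_unit mul_unit_right

end

section \<open>Connections in the presence of an eventual identity\<close>

text \<open>Lie brackets are expressed through \<open>D\<close> by torsion-freeness.
  \<open>D_compatible\<close> is one transposition of total symmetry, the other being commutativity
  of the product; \<open>E_dual\<close> says that the Lie derivative along \<open>E\<close> of the
  dual product is zero.\<close>

locale dual_setting = unital_mult G mul e
  for G :: "'v::ab_group_add set" and mul :: "'v \<Rightarrow> 'v \<Rightarrow> 'v" (infixl "\<diamond>" 70) and e :: 'v +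
  fixes D :: "'v \<Rightarrow> 'v \<Rightarrow> 'v" and E E' :: 'v
  assumes D_closed: "x \<in> G \<Longrightarrow> y \<in> G \<Longrightarrow> D x y \<in> G"
    and D_add_left: "x \<in> G \<Longrightarrow> y \<in> G \<Longrightarrow> z \<in> G \<Longrightarrow> D (x + y) z = D x z + D y z"
    and D_add_right: "x \<in> G \<Longrightarrow> y \<in> G \<Longrightarrow> z \<in> G \<Longrightarrow> D x (y + z) = D x y + D x z"
    and D_compatible: "x \<in> G \<Longrightarrow> y \<in> G \<Longrightarrow> z \<in> G \<Longrightarrow>
      D x (y \<diamond> z) - D x y \<diamond> z - y \<diamond> D x z = D y (x \<diamond> z) - D y x \<diamond> z - x \<diamond> D y z"
    and E_closed: "E \<in> G" and E'_closed: "E' \<in> G" and E_E': "E \<diamond> E' = e"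
    and E_dual: "x \<in> G \<Longrightarrow> y \<in> G \<Longrightarrow>
      D E (x \<diamond> y \<diamond> E') - D (x \<diamond> y \<diamond> E') E =
        (D E x - D x E) \<diamond> y \<diamond> E' + x \<diamond> (D E y - D y E) \<diamond> E'"
begin

lemma D_zero_right: "x \<in> G \<Longrightarrow> D x 0 = 0"
  using D_add_right[of x 0 0] zero_closed by simp

lemma D_uminus_right: "x \<in> G \<Longrightarrow> y \<in> G \<Longrightarrow> D x (- y) = - D x y"
  using D_add_right[of x y "- y"] uminus_closed by (simp add: D_zero_right add_eq_0_iff)

lemma D_diff_right: "x \<in> G \<Longrightarrow> y \<in> G \<Longrightarrow> z \<in> G \<Longrightarrow> D x (y - z) = D x y - D x z"
  using D_add_right[of x y "- z"] uminus_closed by (simp add: D_uminus_right)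

lemma D_diff_left: "x \<in> G \<Longrightarrow> y \<in> G \<Longrightarrow> z \<in> G \<Longrightarrow> D (x - y) z = D x z - D y z"
  using D_add_left[of "x - y" y z] diff_closed by simp

lemmas D_simps = D_closed D_add_left D_add_right D_diff_left D_diff_right E_closed E'_closed

lemma E'_E: "E' \<diamond> E = e"
  using E_E' mul_comm E_closed E'_closed by simp

lemma cancel_E: "x \<in> G \<Longrightarrow> E \<diamond> (E' \<diamond> x) = x" "x \<in> G \<Longrightarrow> E' \<diamond> (E \<diamond> x) = x"
  by (simp_all add: mul_assoc[symmetric] E_closed E'_closed E_E' E'_E mul_unit)

text \<open>For torsion-free \<open>D\<close> this is the Lie bracket, so that \<open>lie_E\<close>
  is the Lie derivative of the original multiplication along \<open>E\<close>.\<close>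

definition bracket :: "'v \<Rightarrow> 'v \<Rightarrow> 'v"
  where "bracket x y = D x y - D y x"

definition lie_E :: "'v \<Rightarrow> 'v \<Rightarrow> 'v"
  where "lie_E x y = bracket E (x \<diamond> y) - bracket E x \<diamond> y - x \<diamond> bracket E y"

lemma bracket_closed: "x \<in> G \<Longrightarrow> y \<in> G \<Longrightarrow> bracket x y \<in> G"
  by (simp add: bracket_def closed D_closed)

lemma lie_E_closed: "x \<in> G \<Longrightarrow> y \<in> G \<Longrightarrow> lie_E x y \<in> G"
  by (simp add: lie_E_def closed bracket_closed E_closed)

text \<open>Expanding the bracket of \<open>E\<close> with the triple product of \<open>x\<close>,
  \<open>y\<close>, \<open>E'\<close> by the definition of \<open>lie_E\<close>, first at
  \<open>x\<close> and then at \<open>y\<close>, gives the two terms of \<open>E_dual\<close> plus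
  the left-hand side here, which must therefore vanish.\<close>

lemma lie_E_dual:
  assumes "x \<in> G" "y \<in> G"
  shows "lie_E x (y \<diamond> E') + x \<diamond> (lie_E y E' + y \<diamond> bracket E E') = 0"
proof -
  have "bracket E (x \<diamond> (y \<diamond> E')) = bracket E x \<diamond> (y \<diamond> E') + x \<diamond> (bracket E y \<diamond> E')"
    using E_dual[OF assms] assms
    by (simp add: bracket_def[symmetric] mul_assoc bracket_closed E_closed E'_closed)
  then show ?thesis
    using assms by (simp add: lie_E_def mul_simps bracket_closed E_closed E'_closed)
qed

text \<open>In \<open>lie_E_dual\<close> the second summand is \<open>x\<close> times a factor free
  of \<open>x\<close>. Setting \<open>x = e\<close> determines this factor, and reinserting it gives
  \<open>lie_E\<close> for every \<open>x\<close>.\<close>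

lemma lie_E_eq:
  assumes "x \<in> G" "y \<in> G"
  shows "lie_E x y = bracket e E \<diamond> (x \<diamond> y)"
proof -
  \<comment> \<open>\<open>lie_E_dual\<close> has second argument \<open>z \<diamond> E'\<close>;
    this choice of \<open>z\<close> turns it into \<open>y\<close>.\<close>
  define z where "z = y \<diamond> E"
  have z: "z \<in> G" "z \<diamond> E' = y"
    using assms by (simp_all add: z_def closed E_closed E'_closed mul_assoc E_E' mul_unit_right)
  have *: "lie_E e (z \<diamond> E') = bracket e E \<diamond> (z \<diamond> E')"
    using z assms
    by (simp add: lie_E_def mul_unit closed bracket_closed E_closed diff_mul[symmetric])
       (simp add: bracket_def diff_mul uminus_mul[symmetric] closed D_closed E_closed)
  have "lie_E z E' + z \<diamond> bracket E E' = - (bracket e E \<diamond> y)"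
    using lie_E_dual[OF unit_closed z(1)] * z
    by (simp add: mul_unit closed bracket_closed lie_E_closed E_closed E'_closed eq_neg_iff_add_eq_0 add.commute)
  then show ?thesis
    using lie_E_dual[OF assms(1) z(1)] z assms
    by (simp add: mul_simps bracket_closed E_closed)
qed

text \<open>Compatibility for the triple \<open>z\<close>, \<open>E\<close>, \<open>u\<close>
  removes the derivatives along \<open>E\<close> from \<open>lie_E z u\<close>. By
  \<open>lie_E_eq\<close> the bracketed expression is then \<open>z\<close> times a term depending
  only on \<open>u\<close>, so multiplying by \<open>x\<close> makes it symmetric in
  \<open>x\<close> and \<open>z\<close>.\<close>

lemma sym_E:
  assumes "x \<in> G" "z \<in> G" "u \<in> G"
  shows "x \<diamond> (E \<diamond> D z u - D z (E \<diamond> u) + D (z \<diamond> u) E) = z \<diamond> (E \<diamond> D x u - D x (E \<diamond> u) + D (x \<diamond> u) E)"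
proof -
  have *: "E \<diamond> D z u - D z (E \<diamond> u) + D (z \<diamond> u) E = z \<diamond> (D u E - bracket e E \<diamond> u)"
    if "z \<in> G" for z
    using arg_cong2[of _ _ _ _ "(+)", OF D_compatible[OF that E_closed assms(3)] lie_E_eq[OF that assms(3)]] that assms
    by (simp add: lie_E_def bracket_def mul_simps D_simps algebra_simps)
  show ?thesis
    unfolding *[OF assms(1)] *[OF assms(2)] using assms
    by (intro mul_left_comm) (simp_all add: closed D_simps bracket_closed)
qed

section \<open>Curvature of the conjugated connection\<close>

definition T :: "'v \<Rightarrow> 'v \<Rightarrow> 'v"
  where "T w u = D u E - w \<diamond> u"

definition B :: "'v \<Rightarrow> 'v \<Rightarrow> 'v \<Rightarrow> 'v"
  where "B w x u = D x u - E' \<diamond> (x \<diamond> T w u)"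

lemma T_closed: "w \<in> G \<Longrightarrow> u \<in> G \<Longrightarrow> T w u \<in> G"
  by (simp add: T_def closed D_closed E_closed)

lemma T_diff: "w \<in> G \<Longrightarrow> u \<in> G \<Longrightarrow> v \<in> G \<Longrightarrow> T w (u - v) = T w u - T w v"
  by (simp add: T_def mul_simps D_simps)

lemma B_closed: "w \<in> G \<Longrightarrow> x \<in> G \<Longrightarrow> u \<in> G \<Longrightarrow> B w x u \<in> G"
  by (simp add: B_def closed T_closed D_closed E'_closed)

text \<open>With \<open>v = T w y\<close>, compatibility turns the derivatives of
  \<open>E' \<diamond> (z \<diamond> v)\<close> and \<open>E' \<diamond> (x \<diamond> v)\<close>
  into derivatives of \<open>E' \<diamond> v\<close>, and \<open>sym_E\<close> turns those into
  derivatives of \<open>v\<close>. What is left is the covariant derivative of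
  \<open>T w\<close>.\<close>

lemma B_curvature:
  assumes [simp]: "w \<in> G" "x \<in> G" "z \<in> G" "y \<in> G"
    and flat: "D x (D z y) - D z (D x y) - D (D x z - D z x) y = 0"
  shows "B w x (B w z y) - B w z (B w x y) - B w (D x z - D z x) y =
    E' \<diamond> ((D z (T w y) - T w (D z y)) \<diamond> x - (D x (T w y) - T w (D x y)) \<diamond> z)"
proof -
  define v where "v = T w y"
  have v [simp]: "v \<in> G" by (simp add: v_def T_closed)
  \<comment> \<open>\<open>sym_E\<close> is taken at \<open>u = E' \<diamond> v\<close>, so that
    \<open>E \<diamond> u\<close> is \<open>v\<close>; the extra factor \<open>E'\<close> clears the
    \<open>E\<close> in front of \<open>D z u\<close>.\<close>
  have sym: "E' \<diamond> (x \<diamond> (E \<diamond> D z (E' \<diamond> v) - D z v + D (z \<diamond> (E' \<diamond> v)) E)) =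
      E' \<diamond> (z \<diamond> (E \<diamond> D x (E' \<diamond> v) - D x v + D (x \<diamond> (E' \<diamond> v)) E))"
    using sym_E[of x z "E' \<diamond> v"] by (simp add: cancel_E closed E'_closed)
  have sym': "x \<diamond> D z (E' \<diamond> v) + E' \<diamond> (x \<diamond> (D (E' \<diamond> (z \<diamond> v)) E - D z v)) =
      z \<diamond> D x (E' \<diamond> v) + E' \<diamond> (z \<diamond> (D (E' \<diamond> (x \<diamond> v)) E - D x v))"
  proof -
    have "x \<diamond> D z (E' \<diamond> v) + E' \<diamond> (x \<diamond> (D (E' \<diamond> (z \<diamond> v)) E - D z v)) =
        E' \<diamond> (x \<diamond> (E \<diamond> D z (E' \<diamond> v) - D z v + D (z \<diamond> (E' \<diamond> v)) E))"
      if [simp]: "x \<in> G" "z \<in> G" for x z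
      using mul_left_comm[of x E "D z (E' \<diamond> v)"] mul_left_comm[of z E' v]
      by (simp add: mul_add mul_diff cancel_E closed D_closed E_closed E'_closed)
    then show ?thesis using sym by simp
  qed
  \<comment> \<open>The terms with \<open>D x z\<close> and \<open>D z x\<close> will absorb the
    bracket term of \<open>B_br\<close>.\<close>
  have comp: "D x (E' \<diamond> (z \<diamond> v)) - D x z \<diamond> (E' \<diamond> v) - z \<diamond> D x (E' \<diamond> v) =
      D z (E' \<diamond> (x \<diamond> v)) - D z x \<diamond> (E' \<diamond> v) - x \<diamond> D z (E' \<diamond> v)"
    using D_compatible[of x z "E' \<diamond> v"] by (simp add: closed E'_closed mul_left_comm)
  have T_E': "T w (E' \<diamond> (a \<diamond> v)) = D (E' \<diamond> (a \<diamond> v)) E - w \<diamond> (E' \<diamond> (a \<diamond> v))" for a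
    by (simp add: T_def)
  \<comment> \<open>The last term, containing \<open>w\<close>, is symmetric in \<open>a\<close> and
    \<open>b\<close> and disappears from the commutator.\<close>
  have B_B: "B w a (B w b y) = D a (D b y) - D a (E' \<diamond> (b \<diamond> v))
      - E' \<diamond> (a \<diamond> (T w (D b y) - D (E' \<diamond> (b \<diamond> v)) E + w \<diamond> (E' \<diamond> (b \<diamond> v))))"
    if [simp]: "a \<in> G" "b \<in> G" for a b
    by (simp add: B_def v_def[symmetric] T_diff T_E' D_simps closed diff_diff_eq2 add_diff_eq
        flip: diff_add_eq)
  have B_br: "B w (D x z - D z x) y = D (D x z - D z x) y - (D x z - D z x) \<diamond> (E' \<diamond> v)"
    by (simp add: B_def v_def[symmetric] mul_simps D_simps)
  show ?thesis
    unfolding B_B[OF assms(2,3)] B_B[OF assms(3,2)] B_br v_def[symmetric]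
    using arg_cong2[of _ _ _ _ "(+)", OF arg_cong2[of _ _ _ _ "(+)", OF sym' comp[symmetric]] flat]
    by (simp add: mul_simps D_closed T_closed E_closed E'_closed algebra_simps)
qed

section \<open>The dual connection and its flatness criterion\<close>

text \<open>The last summand is the dual product \<open>w * x * y\<close> written out in
  \<open>\<diamond>\<close>. The parameter corresponds to W itself, whereas \<open>T\<close> and
  \<open>B\<close> take \<open>w \<diamond> E'\<close>.\<close>

definition dual :: "'v \<Rightarrow> 'v \<Rightarrow> 'v \<Rightarrow> 'v"
  where "dual w x y = E \<diamond> D x (E' \<diamond> y) - D (E' \<diamond> y) E \<diamond> x + w \<diamond> x \<diamond> E' \<diamond> y \<diamond> E'"

lemma dual_closed: "w \<in> G \<Longrightarrow> x \<in> G \<Longrightarrow> y \<in> G \<Longrightarrow> dual w x y \<in> G"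
  by (simp add: dual_def closed D_closed E_closed E'_closed)

lemma dual_eq_B:
  assumes [simp]: "w \<in> G" "x \<in> G" "y \<in> G"
  shows "dual w x y = E \<diamond> B (w \<diamond> E') x (E' \<diamond> y)"
proof -
  have *: "E \<diamond> (E' \<diamond> (x \<diamond> T (w \<diamond> E') (E' \<diamond> y))) = x \<diamond> T (w \<diamond> E') (E' \<diamond> y)"
    by (simp add: cancel_E closed T_closed E'_closed)
  show ?thesis
    by (simp add: dual_def B_def mul_diff * closed T_closed D_closed E_closed E'_closed)
       (simp add: T_def mul_simps D_simps)
qed

text \<open>In a composition of two dual derivatives the inner \<open>E\<close> meets the outer
  \<open>E'\<close> and cancels, so curvature is conjugated along with the connection.\<close>

lemma dual_curvature:
  assumes [simp]: "w \<in> G" "x \<in> G" "z \<in> G" "y \<in> G"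
  shows "dual w x (dual w z y) - dual w z (dual w x y) - dual w (D x z - D z x) y =
    E \<diamond> (B (w \<diamond> E') x (B (w \<diamond> E') z (E' \<diamond> y)) - B (w \<diamond> E') z (B (w \<diamond> E') x (E' \<diamond> y))
      - B (w \<diamond> E') (D x z - D z x) (E' \<diamond> y))"
  by (simp add: dual_eq_B cancel_E mul_diff closed B_closed D_closed E_closed E'_closed)

text \<open>The factor \<open>E\<close> from conjugation cancels the factor \<open>E'\<close> of
  \<open>B_curvature\<close>, so the dual curvature at \<open>y\<close> is exactly the defect of
  symmetry at \<open>E' \<diamond> y\<close>.\<close>

theorem dual_flat_iff:
  assumes [simp]: "w \<in> G"
    and flat: "\<And>x z y. x \<in> G \<Longrightarrow> z \<in> G \<Longrightarrow> y \<in> G \<Longrightarrow> D x (D z y) - D z (D x y) - D (D x z - D z x) y = 0"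
  shows "(\<forall>x\<in>G. \<forall>z\<in>G. \<forall>y\<in>G. dual w x (dual w z y) - dual w z (dual w x y) - dual w (D x z - D z x) y = 0)
    \<longleftrightarrow> (\<forall>x\<in>G. \<forall>y\<in>G. \<forall>z\<in>G.
      (D x (T (w \<diamond> E') y) - T (w \<diamond> E') (D x y)) \<diamond> z = (D z (T (w \<diamond> E') y) - T (w \<diamond> E') (D z y)) \<diamond> x)"
    (is "?flat \<longleftrightarrow> ?sym")
proof -
  let ?N = "\<lambda>x y z. (D x (T (w \<diamond> E') y) - T (w \<diamond> E') (D x y)) \<diamond> z"
  have N: "?N x y z \<in> G" if "x \<in> G" "y \<in> G" "z \<in> G" for x y z
    using that by (simp add: closed D_closed T_closed E'_closed)
  have *: "dual w x (dual w z y) - dual w z (dual w x y) - dual w (D x z - D z x) y =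
      ?N z (E' \<diamond> y) x - ?N x (E' \<diamond> y) z"
    if "x \<in> G" "z \<in> G" "y \<in> G" for x z y
    unfolding dual_curvature[OF assms(1) that] using that N
    by (simp add: B_curvature flat closed E'_closed cancel_E)
  show ?thesis
  proof
    assume h: ?flat
    show ?sym
    proof (intro ballI)
      fix x y z assume "x \<in> G" "y \<in> G" "z \<in> G"
      \<comment> \<open>Every \<open>y\<close> has the form
        \<open>E' \<diamond> (E \<diamond> y)\<close>, so vanishing curvature gives the symmetry at
        all \<open>y\<close>.\<close>
      with h *[of x z "E \<diamond> y"] show "?N x y z = ?N z y x"
        by (simp add: cancel_E closed E_closed)
    qed
  next
    assume ?sym
    then show ?flat using * by (simp add: closed E'_closed)
  qed
qed

end

section \<open>Vector fields on an F-manifold as an instance\<close>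

lemma unital_mult_vfields:
  assumes "F_manifold A m e"
  shows "unital_mult (vfields A) (\<lambda>X Y. X \<odot>\<^bsub>m\<^esub> Y) e"
proof -
  have t: "X p \<in> tangent_space A p" if "X \<in> vfields A" for X p
    using that by (simp add: vfields_def)
  have A: "smooth_atlas A" "comm_assoc_mult A m" "unit_field A m e"
    using assms by (auto simp: F_manifold_def)
  have m: "m p u v = m p v u" "m p (u + v) w = m p u w + m p v w"
    "m p (m p u v) w = m p u (m p v w)" "m p u v \<in> tangent_space A p"
    if "u \<in> tangent_space A p" "v \<in> tangent_space A p" "w \<in> tangent_space A p" for p u v w
    using A(2)[unfolded comm_assoc_mult_def, THEN conjunct1, rule_format, OF that(1,2)] that(3) by metis+
  have m': "m p w (u + v) = m p w u + m p w v"
    if "u \<in> tangent_space A p" "v \<in> tangent_space A p" "w \<in> tangent_space A p" for p u v w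
    using that m(1)[of w p "u + v" w] m(1)[of w p u w] m(1)[of w p v w] m(2)[of u p v w] tangent_space_add[of u A p v]
    by simp
  have c: "X \<odot>\<^bsub>m\<^esub> Y \<in> vfields A" if "X \<in> vfields A" "Y \<in> vfields A" for X Y
    using A(2)[unfolded comm_assoc_mult_def, THEN conjunct2] that by blast
  show ?thesis
  proof
    show "e \<in> vfields A"
      using A(3) by (simp add: unit_field_def)
    fix X Y Z assume X: "X \<in> vfields A"
    show "- X \<in> vfields A"
      using A(1) X by (rule vfields_uminus)
    show "e \<odot>\<^bsub>m\<^esub> X = X"
      using A(3) t[OF X] by (simp add: vmult_def unit_field_def)
    assume Y: "Y \<in> vfields A"
    show "X + Y \<in> vfields A"
      using A(1) X Y by (rule vfields_add)
    show "X \<odot>\<^bsub>m\<^esub> Y \<in> vfields A"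
      using X Y by (rule c)
    show "X \<odot>\<^bsub>m\<^esub> Y = Y \<odot>\<^bsub>m\<^esub> X"
      unfolding vmult_def using m(1)[OF t[OF X] t[OF Y] t[OF Y]] by simp
    assume Z: "Z \<in> vfields A"
    show "X \<odot>\<^bsub>m\<^esub> Y \<odot>\<^bsub>m\<^esub> Z = X \<odot>\<^bsub>m\<^esub> (Y \<odot>\<^bsub>m\<^esub> Z)"
      unfolding vmult_def using m(3)[OF t[OF X] t[OF Y] t[OF Z]] by simp
    show "X \<odot>\<^bsub>m\<^esub> (Y + Z) = X \<odot>\<^bsub>m\<^esub> Y + X \<odot>\<^bsub>m\<^esub> Z"
      unfolding vmult_def using m'[OF t[OF Y] t[OF Z] t[OF X]] by (simp add: plus_fun_def)
  qed
qed


lemma dual_vmult: "X \<odot>\<^bsub>dual_mult A m e E\<^esub> Y = X \<odot>\<^bsub>m\<^esub> Y \<odot>\<^bsub>m\<^esub> inverse_field A m e E"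
  by (simp add: vmult_def dual_mult_def)

text \<open>The definite description is meaningful because inverses are unique in a commutative
  monoid: two inverses of \<open>E\<close> both equal their product with each other and
  \<open>E\<close>.\<close>

lemma inverse_field:
  assumes "F_manifold A m e" and "invertible_field A m e E"
  shows "inverse_field A m e E \<in> vfields A" and "E \<odot>\<^bsub>m\<^esub> inverse_field A m e E = e"
proof -
  interpret unital_mult "vfields A" "\<lambda>X Y. X \<odot>\<^bsub>m\<^esub> Y" e
    by (rule unital_mult_vfields[OF assms(1)])
  obtain F where F: "E \<in> vfields A" "F \<in> vfields A" "E \<odot>\<^bsub>m\<^esub> F = e"
    using assms(2) by (auto simp: invertible_field_def)
  have "G = F" if "G \<in> vfields A" "E \<odot>\<^bsub>m\<^esub> G = e" for G
    by (metis F mul_comm mul_left_comm mul_unit_right that)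
  then have "\<exists>!F. F \<in> vfields A \<and> E \<odot>\<^bsub>m\<^esub> F = e"
    using F by blast
  from theI'[OF this] show "inverse_field A m e E \<in> vfields A" "E \<odot>\<^bsub>m\<^esub> inverse_field A m e E = e"
    by (simp_all add: inverse_field_def)
qed

text \<open>Applied to \<open>e \<circ> e = e\<close>, the F-manifold identity says that the Lie
  derivative along \<open>e\<close> equals twice itself.\<close>

lemma lie_mult_unit:
  assumes "F_manifold A m e" and "connection A D" and "torsion_free A D"
    and "X \<in> vfields A" "Y \<in> vfields A"
  shows "lie_mult m e X Y = 0"
proof -
  interpret unital_mult "vfields A" "\<lambda>X Y. X \<odot>\<^bsub>m\<^esub> Y" e
    by (rule unital_mult_vfields[OF assms(1)])
  \<comment> \<open>Torsion-freeness gives closure under brackets, since the bracket is a difference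
    of two covariant derivatives.\<close>
  have "lie_bracket X Y \<in> vfields A" if "X \<in> vfields A" "Y \<in> vfields A" for X Y
  proof -
    have "D X Y \<in> vfields A" "D Y X \<in> vfields A"
      using assms(2) that by (auto simp: connection_def)
    then show ?thesis
      using assms(3) that diff_closed[of "D X Y" "D Y X"] by (simp add: torsion_free_def)
  qed
  then have "lie_mult m e X Y \<in> vfields A"
    using assms(4,5) by (simp add: lie_mult_def closed)
  moreover have "lie_mult m (e \<odot>\<^bsub>m\<^esub> e) X Y = e \<odot>\<^bsub>m\<^esub> lie_mult m e X Y + e \<odot>\<^bsub>m\<^esub> lie_mult m e X Y"
    using assms(1,4,5) unit_closed by (auto simp: F_manifold_def)
  ultimately show ?thesis
    by (simp add: mul_unit closed)
qed

lemma dual_setting_vfields: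
  assumes F: "F_manifold A m e" and ev: "eventual_identity A m e E"
    and D: "connection A D" "torsion_free A D" "compatible A m D"
  shows "dual_setting (vfields A) (\<lambda>X Y. X \<odot>\<^bsub>m\<^esub> Y) e D E (inverse_field A m e E)"
proof -
  let ?E' = "inverse_field A m e E"
  interpret unital_mult "vfields A" "\<lambda>X Y. X \<odot>\<^bsub>m\<^esub> Y" e
    by (rule unital_mult_vfields[OF F])
  have inv: "invertible_field A m e E" and F': "F_manifold A (dual_mult A m e E) E"
    using ev by (simp_all add: eventual_identity_def)
  have E: "E \<in> vfields A"
    using inv by (simp add: invertible_field_def)
  have tf: "lie_bracket X Y = D X Y - D Y X" if "X \<in> vfields A" "Y \<in> vfields A" for X Y
    using D(2) that by (simp add: torsion_free_def)
  show ?thesis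
  proof
    fix X Y Z assume X: "X \<in> vfields A" and Y: "Y \<in> vfields A"
    show "D X Y \<in> vfields A"
      using D(1) X Y by (auto simp: connection_def)
    show "D E (X \<odot>\<^bsub>m\<^esub> Y \<odot>\<^bsub>m\<^esub> ?E') - D (X \<odot>\<^bsub>m\<^esub> Y \<odot>\<^bsub>m\<^esub> ?E') E =
        (D E X - D X E) \<odot>\<^bsub>m\<^esub> Y \<odot>\<^bsub>m\<^esub> ?E' + X \<odot>\<^bsub>m\<^esub> (D E Y - D Y E) \<odot>\<^bsub>m\<^esub> ?E'"
      \<comment> \<open>\<open>lie_mult_unit\<close> is applied to the dual F-manifold, whose unit
        field is \<open>E\<close>; being a torsion-free connection does not involve the
        multiplication.\<close>
      using lie_mult_unit[OF F' D(1,2) X Y] X Y E inverse_field[OF F inv]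
      by (simp add: lie_mult_def dual_vmult tf closed diff_diff_eq)
    assume Z: "Z \<in> vfields A"
    show "D (X + Y) Z = D X Z + D Y Z" "D X (Y + Z) = D X Y + D X Z"
      using D(1) X Y Z by (auto simp: connection_def)
    show "D X (Y \<odot>\<^bsub>m\<^esub> Z) - D X Y \<odot>\<^bsub>m\<^esub> Z - Y \<odot>\<^bsub>m\<^esub> D X Z =
        D Y (X \<odot>\<^bsub>m\<^esub> Z) - D Y X \<odot>\<^bsub>m\<^esub> Z - X \<odot>\<^bsub>m\<^esub> D Y Z"
      using D(3) X Y Z by (auto simp: compatible_def deriv_mult_def)
  qed (use E inverse_field[OF F inv] in auto)
qed

section \<open>Function-linearity and the Leibniz rule for the dual connection\<close>

lemma fscale_add: "fscale f (X + Y) = fscale f X + fscale f Y"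
  by (simp add: fscale_def fun_eq_iff algebra_simps)

lemma fscale_diff: "fscale f (X - Y) = fscale f X - fscale f Y"
  by (simp add: fscale_def fun_eq_iff algebra_simps)

lemma fscale_vmult:
  assumes "F_manifold A m e" and "X \<in> vfields A" "Y \<in> vfields A"
  shows "fscale f X \<odot>\<^bsub>m\<^esub> Y = fscale f (X \<odot>\<^bsub>m\<^esub> Y)"
proof -
  have "m p (\<lambda>g. c * X p g) (Y p) = (\<lambda>g. c * m p (X p) (Y p) g)" for p c
    using assms by (auto simp: F_manifold_def comm_assoc_mult_def vfields_def)
  then show ?thesis
    by (simp add: vmult_def fscale_def)
qed

lemma vmult_fscale:
  assumes "F_manifold A m e" and "f \<in> smooth_fun A" and "X \<in> vfields A" "Y \<in> vfields A"
  shows "X \<odot>\<^bsub>m\<^esub> fscale f Y = fscale f (X \<odot>\<^bsub>m\<^esub> Y)"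
proof -
  interpret unital_mult "vfields A" "\<lambda>X Y. X \<odot>\<^bsub>m\<^esub> Y" e
    by (rule unital_mult_vfields[OF assms(1)])
  have "fscale f Y \<in> vfields A"
    using assms by (simp add: vfields_fscale F_manifold_def)
  then show ?thesis
    using assms mul_comm fscale_vmult[OF assms(1,4,3)] by metis
qed

lemma connection_dual_connection:
  assumes F: "F_manifold A m e" and ev: "eventual_identity A m e E"
    and D: "connection A D" "torsion_free A D" "compatible A m D"
    and W: "W \<in> vfields A"
  shows "connection A (dual_connection A m e E D W)"
proof -
  let ?E' = "inverse_field A m e E" and ?D' = "dual_connection A m e E D W"
  interpret dual_setting "vfields A" "\<lambda>X Y. X \<odot>\<^bsub>m\<^esub> Y" e D E ?E'
    by (rule dual_setting_vfields[OF F ev D])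
  have eq: "?D' X Y = dual W X Y" if "X \<in> vfields A" "Y \<in> vfields A" for X Y
    using that by (simp add: dual_connection_def dual_def dual_vmult Let_def)
  note cl = closed D_closed E_closed E'_closed W
  have fs: "fscale f X \<in> vfields A" if "f \<in> smooth_fun A" "X \<in> vfields A" for f X
    using F that by (simp add: vfields_fscale F_manifold_def)
  have Xf: "(\<lambda>p. X p f) \<in> smooth_fun A" if "f \<in> smooth_fun A" "X \<in> vfields A" for f X
    using that by (simp add: vfields_def)
  have D_fs: "D (fscale f X) Y = fscale f (D X Y)"
    "D X (fscale f Y) = fscale (\<lambda>p. X p f) Y + fscale f (D X Y)"
    if "f \<in> smooth_fun A" "X \<in> vfields A" "Y \<in> vfields A" for f X Y
    using D(1) that by (auto simp: connection_def)
  note fv = fscale_vmult[OF F] vmult_fscale[OF F]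
  show ?thesis
    unfolding connection_def
  proof (intro conjI ballI)
    show "?D' \<in> vfields A \<rightarrow>\<^sub>E vfields A \<rightarrow>\<^sub>E vfields A"
      using eq dual_closed[OF W] by (auto simp: dual_connection_def Let_def PiE_iff)
  next
    fix X Y Z assume [simp]: "X \<in> vfields A" "Y \<in> vfields A" "Z \<in> vfields A"
    show "?D' (X + Y) Z = ?D' X Z + ?D' Y Z"
      by (simp add: eq cl) (simp add: dual_def D_simps mul_simps W)
    show "?D' X (Y + Z) = ?D' X Y + ?D' X Z"
      by (simp add: eq cl) (simp add: dual_def D_simps mul_simps W)
  next
    fix f X Y assume [simp]: "f \<in> smooth_fun A" "X \<in> vfields A" "Y \<in> vfields A"
    show "?D' (fscale f X) Y = fscale f (?D' X Y)"
      by (simp add: eq fs) (simp add: dual_def fscale_add fscale_diff fv D_fs fs cl)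
    \<comment> \<open>The Leibniz rule for \<open>D\<close> produces the derivative of
      \<open>f\<close> times \<open>E \<circ> (E' \<circ> Y)\<close>; the other summands of the dual
      connection are function-linear in \<open>Y\<close>.\<close>
    have "E \<odot>\<^bsub>m\<^esub> (?E' \<odot>\<^bsub>m\<^esub> Y) = Y"
      by (simp add: cancel_E)
    then show "?D' X (fscale f Y) = fscale (\<lambda>p. X p f) Y + fscale f (?D' X Y)"
      by (simp add: eq fs) (simp add: dual_def fscale_add fscale_diff fv D_fs fs cl Xf mul_add)
  qed
qed

section \<open>Flatness of a single dual connection\<close>

lemma flat_dual_connection_iff:
  assumes F: "F_manifold A m e" and ev: "eventual_identity A m e E"
    and D: "connection A D" "torsion_free A D" "compatible A m D"
    and flat: "flat_connection A D" and W: "W \<in> vfields A"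
  shows "flat_connection A (dual_connection A m e E D W) \<longleftrightarrow>
    flatness_relation A m D E (W \<odot>\<^bsub>m\<^esub> inverse_field A m e E)"
proof -
  let ?E' = "inverse_field A m e E" and ?D' = "dual_connection A m e E D W"
  interpret dual_setting "vfields A" "\<lambda>X Y. X \<odot>\<^bsub>m\<^esub> Y" e D E ?E'
    by (rule dual_setting_vfields[OF F ev D])
  have eq: "?D' X Y = dual W X Y" if "X \<in> vfields A" "Y \<in> vfields A" for X Y
    using that by (simp add: dual_connection_def dual_def dual_vmult Let_def)
  have tf: "lie_bracket X Y = D X Y - D Y X" if "X \<in> vfields A" "Y \<in> vfields A" for X Y
    using D(2) that by (simp add: torsion_free_def)
  \<comment> \<open>The Lie bracket does not depend on the connection, so it may be expressed
    through \<open>D\<close> also in the curvature of the dual connection.\<close>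
  have curv: "curvature ?D' X Y Z = dual W X (dual W Y Z) - dual W Y (dual W X Z) - dual W (D X Y - D Y X) Z"
    if "X \<in> vfields A" "Y \<in> vfields A" "Z \<in> vfields A" for X Y Z
    using that by (simp add: curvature_def eq tf closed D_closed dual_closed W)
  have "D X (D Y Z) - D Y (D X Z) - D (D X Y - D Y X) Z = 0"
    if "X \<in> vfields A" "Y \<in> vfields A" "Z \<in> vfields A" for X Y Z
    using flat that by (simp add: flat_connection_def curvature_def tf)
  note iff = dual_flat_iff[OF W this]
  have T_eq: "second_deriv D X Y E - deriv_mult_endo D m X (W \<odot>\<^bsub>m\<^esub> ?E') Y =
      D X (T (W \<odot>\<^bsub>m\<^esub> ?E') Y) - T (W \<odot>\<^bsub>m\<^esub> ?E') (D X Y)"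
    if "X \<in> vfields A" "Y \<in> vfields A" for X Y
    using that by (simp add: second_deriv_def deriv_mult_endo_def T_def D_simps closed W)
  have "flat_connection A ?D' \<longleftrightarrow> (\<forall>X\<in>vfields A. \<forall>Y\<in>vfields A. \<forall>Z\<in>vfields A.
      dual W X (dual W Y Z) - dual W Y (dual W X Z) - dual W (D X Y - D Y X) Z = 0)"
    using connection_dual_connection[OF F ev D W] by (simp add: flat_connection_def curv)
  also have "\<dots> \<longleftrightarrow> flatness_relation A m D E (W \<odot>\<^bsub>m\<^esub> ?E')"
    using iff by (simp add: flatness_relation_def T_eq)
  finally show ?thesis .
qed

section \<open>Changing the connection within the special family\<close>

text \<open>The shift \<open>V \<circ> X \<circ> Y\<close> is symmetric in \<open>X\<close> and
  \<open>Y\<close>, hence leaves the torsion alone, and it changes the derivative of the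
  multiplication by \<open>- V \<circ> X \<circ> Y \<circ> Z\<close>, which is totally
  symmetric.\<close>

lemma shifted_connection_torsion_free_compatible:
  assumes F: "F_manifold A m e"
    and D: "connection A D" "torsion_free A D" "compatible A m D" and V: "V \<in> vfields A"
  shows "torsion_free A (shifted_connection A m D V)" and "compatible A m (shifted_connection A m D V)"
proof -
  interpret unital_mult "vfields A" "\<lambda>X Y. X \<odot>\<^bsub>m\<^esub> Y" e
    by (rule unital_mult_vfields[OF F])
  have cl: "D X Y \<in> vfields A" if "X \<in> vfields A" "Y \<in> vfields A" for X Y
    using D(1) that by (auto simp: connection_def)
  show "torsion_free A (shifted_connection A m D V)"
    using D(2) V by (simp add: torsion_free_def shifted_connection_def mul_simps)
  have "deriv_mult (shifted_connection A m D V) m X Y Z =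
      deriv_mult D m X Y Z - V \<odot>\<^bsub>m\<^esub> (X \<odot>\<^bsub>m\<^esub> (Y \<odot>\<^bsub>m\<^esub> Z))"
    if "X \<in> vfields A" "Y \<in> vfields A" "Z \<in> vfields A" for X Y Z
    using that V by (simp add: deriv_mult_def shifted_connection_def mul_simps cl)
  then show "compatible A m (shifted_connection A m D V)"
    using D(3) unfolding compatible_def by (simp add: mul_comm mul_left_comm closed)
qed

text \<open>The shift by \<open>V\<close> contributes \<open>V \<circ> X \<circ> Y\<close> to both terms of the dual connection, and these cancel.\<close>

lemma dual_connection_shifted:
  assumes F: "F_manifold A m e" and ev: "eventual_identity A m e E"
    and D: "connection A D" "torsion_free A D" "compatible A m D" and V: "V \<in> vfields A"
  shows "dual_connection A m e E (shifted_connection A m D V) W = dual_connection A m e E D W"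
proof -
  let ?E' = "inverse_field A m e E"
  interpret dual_setting "vfields A" "\<lambda>X Y. X \<odot>\<^bsub>m\<^esub> Y" e D E ?E'
    by (rule dual_setting_vfields[OF F ev D])
  note cl = closed D_closed E_closed E'_closed V
  have "E \<odot>\<^bsub>m\<^esub> (D X (?E' \<odot>\<^bsub>m\<^esub> Y) + V \<odot>\<^bsub>m\<^esub> X \<odot>\<^bsub>m\<^esub> (?E' \<odot>\<^bsub>m\<^esub> Y))
      - (D (?E' \<odot>\<^bsub>m\<^esub> Y) E + V \<odot>\<^bsub>m\<^esub> (?E' \<odot>\<^bsub>m\<^esub> Y) \<odot>\<^bsub>m\<^esub> E) \<odot>\<^bsub>m\<^esub> X =
    E \<odot>\<^bsub>m\<^esub> D X (?E' \<odot>\<^bsub>m\<^esub> Y) - D (?E' \<odot>\<^bsub>m\<^esub> Y) E \<odot>\<^bsub>m\<^esub> X"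
    if [simp]: "X \<in> vfields A" "Y \<in> vfields A" for X Y
    by (simp add: mul_simps cl)
  then show ?thesis
    by (simp add: dual_connection_def shifted_connection_def Let_def cl cong: restrict_cong)
qed

section \<open>Flat connections in the dual family\<close>

theorem theorem28:
  fixes A :: "('a::{t2_space, second_countable_topology}, 'b::euclidean_space) atlas"
    and m :: "'a tmult" and e E :: "'a vfield" and S :: "'a conn set" and D :: "'a conn"
  assumes "F_manifold A m e"
    and "eventual_identity A m e E"
    and "special_family A m S"
    and "D \<in> S" and "flat_connection A D"
  shows "((\<exists>D'\<in>dual_family A m e E S. flat_connection A D') \<longleftrightarrow>
           (\<exists>W\<in>vfields A. flatness_relation A m D E W)) \<and>
         (\<forall>W\<in>vfields A. flatness_relation A m D E W \<longrightarrow>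
            dual_connection A m e E D (W \<odot>\<^bsub>m\<^esub> E) \<in> dual_family A m e E S \<and>
            flat_connection A (dual_connection A m e E D (W \<odot>\<^bsub>m\<^esub> E)))"
proof -
  let ?E' = "inverse_field A m e E"
  obtain D0 where D0: "connection A D0" "torsion_free A D0" "compatible A m D0"
    and S: "S = {shifted_connection A m D0 V | V. V \<in> vfields A}"
    using assms(3) by (auto simp: special_family_def)
  obtain V where V: "V \<in> vfields A" "D = shifted_connection A m D0 V"
    using assms(4) S by auto
  have D: "connection A D" "torsion_free A D" "compatible A m D"
    using assms(5) shifted_connection_torsion_free_compatible[OF assms(1) D0 V(1)] V(2)
    by (simp_all add: flat_connection_def)
  interpret dual_setting "vfields A" "\<lambda>X Y. X \<odot>\<^bsub>m\<^esub> Y" e D E ?E'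
    by (rule dual_setting_vfields[OF assms(1,2) D])
  note flat_iff = flat_dual_connection_iff[OF assms(1,2) D assms(5)]
  \<comment> \<open>Both \<open>D'\<close> and the flat \<open>D\<close> are shifts of
    \<open>D0\<close>, so each has the same dual connections as \<open>D0\<close>. A flat member of
    the dual family can therefore be taken to be built from \<open>D\<close>.\<close>
  have same: "dual_connection A m e E D' W = dual_connection A m e E D W" if "D' \<in> S" for D' W
    using that V S by (auto simp: dual_connection_shifted[OF assms(1,2) D0])
  have necessary: "\<exists>W\<in>vfields A. flatness_relation A m D E W"
    if D': "D' \<in> dual_family A m e E S" "flat_connection A D'" for D'
  proof -
    obtain D1 W where "D1 \<in> S" and W: "W \<in> vfields A" "D' = dual_connection A m e E D1 W"
      using D'(1) unfolding dual_family_def by blast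
    then have "flatness_relation A m D E (W \<odot>\<^bsub>m\<^esub> ?E')"
      using D'(2) flat_iff same by simp
    then show ?thesis
      using W(1) by (blast intro: mul_closed E'_closed)
  qed
  have sufficient: "dual_connection A m e E D (W \<odot>\<^bsub>m\<^esub> E) \<in> dual_family A m e E S"
    "flat_connection A (dual_connection A m e E D (W \<odot>\<^bsub>m\<^esub> E))"
    if "W \<in> vfields A" "flatness_relation A m D E W" for W
  proof -
    \<comment> \<open>The criterion concerns the parameter times \<open>E'\<close>; the parameter
      \<open>W \<circ> E\<close> makes this \<open>W\<close>, the field in the given
      relation.\<close>
    have WE: "W \<odot>\<^bsub>m\<^esub> E \<in> vfields A" "W \<odot>\<^bsub>m\<^esub> E \<odot>\<^bsub>m\<^esub> ?E' = W"
      using that(1) by (simp_all add: closed E_closed E'_closed mul_assoc E_E' mul_unit_right)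
    show "dual_connection A m e E D (W \<odot>\<^bsub>m\<^esub> E) \<in> dual_family A m e E S"
      using WE(1) assms(4) by (auto simp: dual_family_def)
    show "flat_connection A (dual_connection A m e E D (W \<odot>\<^bsub>m\<^esub> E))"
      using that(2) WE by (simp add: flat_iff)
  qed
  from necessary sufficient show ?thesis by blast
qed

end
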